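(* Let $f:\mathbb{R}^n\to\mathbb{R}$ be a strictly convex quadratic function with minimizer $x^*$ and denote $H:=\nabla^2 f(x^* )$. Let $\overline{m}$ be an upper bound for the eigenvalues of $H$ and let $\underline{m}>0$ be a lower bound for the eigenvalues of $H$, and set $\kappa:=\overline{m}/\underline{m}$ (so that $\kappa$ is an upper bound for the condition number of $H$). Assume that $\kappa\ge 28$. In Nesterov's accelerated gradient method (NAG) let $\alpha=1/\overline{m}$, $\underline{\alpha}=1/\kappa$ and $\beta=\dfrac{\left(1-\sqrt{\underline{\alpha}}\right)^2}{1-\underline{\alpha}}$, and let $0<\epsilon\le 1/\kappa$ be given. Then, for any $x^0\in\mathbb{R}^n$, after $$k=1+\left\lceil 2\sqrt{\kappa}\,\ln\left(\tfrac{2}{\epsilon}\right)\right\rceil$$ steps of (NAG) started at $x^0$, the point $\bar x^k:=\tfrac12(x^{k-1}+x^k)$ satisfies $$\|\bar x^k-x^*\|_2\le \epsilon\,\|x^0-x^*\|_2 .$$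
   Context: Nesterov's accelerated gradient method (NAG) with parameters $\alpha,\beta>0$, applied to a differentiable function $f:\mathbb{R}^n\to\mathbb{R}$ with starting point $x^0\in\mathbb{R}^n$, is defined as follows: set $y^0:=x^0$ and for $k\ge 0$ let $$y^{k+1}:=x^k-\alpha\nabla f(x^k),\qquad x^{k+1}:=y^{k+1}+\beta(y^{k+1}-y^k).$$ "After $k$ steps" means that the iterates $x^1,\dots,x^k$ have been generated. $\|\cdot\|_2$ is the Euclidean norm, $\ln$ is the natural logarithm, and the condition number of the symmetric positive definite matrix $H$ is the ratio of its largest to its smallest eigenvalue. The quantity $\kappa$ is denoted $\overline{\mathrm{cond}}(H)$ in the source. *)

theory Defs
  imports "HOL-Analysis.Analysis"
begin

definition strictly_convex_on :: "'a::real_vector set \<Rightarrow> ('a \<Rightarrow> real) \<Rightarrow> bool" where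
  "strictly_convex_on S f \<longleftrightarrow> convex S \<and>
     (\<forall>x\<in>S. \<forall>y\<in>S. \<forall>t. x \<noteq> y \<longrightarrow> 0 < t \<longrightarrow> t < 1 \<longrightarrow>
        f ((1 - t) *\<^sub>R x + t *\<^sub>R y) < (1 - t) * f x + t * f y)"

text \<open>The matrix below need not be symmetric; only its symmetric part matters for \<open>f\<close>, and
  the Hessian of \<open>f\<close> is \<open>A + transpose A\<close>.\<close>

definition quadratic_function :: "(real ^ 'n \<Rightarrow> real) \<Rightarrow> bool" where
  "quadratic_function f \<longleftrightarrow>
     (\<exists>(A :: real ^ 'n ^ 'n) b c. \<forall>x. f x = x \<bullet> (A *v x) + b \<bullet> x + c)"

text \<open>Meaningful only where \<open>f\<close> is differentiable; there the gradient is unique.\<close>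

definition gradient :: "(real ^ 'n \<Rightarrow> real) \<Rightarrow> real ^ 'n \<Rightarrow> real ^ 'n" where
  "gradient f x = (THE g. GDERIV f x :> g)"

definition hessian :: "(real ^ 'n \<Rightarrow> real) \<Rightarrow> real ^ 'n \<Rightarrow> real ^ 'n ^ 'n" where
  "hessian f x = jacobian (gradient f) (at x)"

definition eigenvalue :: "real ^ 'n ^ 'n \<Rightarrow> real \<Rightarrow> bool" where
  "eigenvalue A l \<longleftrightarrow> (\<exists>v. v \<noteq> 0 \<and> A *v v = l *\<^sub>R v)"

fun nag_x nag_y ::
    "real \<Rightarrow> real \<Rightarrow> (real ^ 'n \<Rightarrow> real) \<Rightarrow> real ^ 'n \<Rightarrow> nat \<Rightarrow> real ^ 'n" where
  "nag_y \<alpha> \<beta> f x0 0 = x0"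
| "nag_y \<alpha> \<beta> f x0 (Suc k) = nag_x \<alpha> \<beta> f x0 k - \<alpha> *\<^sub>R gradient f (nag_x \<alpha> \<beta> f x0 k)"
| "nag_x \<alpha> \<beta> f x0 0 = x0"
| "nag_x \<alpha> \<beta> f x0 (Suc k) = nag_y \<alpha> \<beta> f x0 (Suc k)
     + \<beta> *\<^sub>R (nag_y \<alpha> \<beta> f x0 (Suc k) - nag_y \<alpha> \<beta> f x0 k)"

end

theory Submission
  imports Defs
begin

text \<open>
  Put \<open>s = 1 / sqrt \<kappa>\<close>. The gradient at \<open>x\<close> is \<open>H (x - x\<^sup>*)\<close>, so a gradient step multiplies the
  error by \<open>M = I - \<alpha> H\<close>, and the eigenvalue bounds say that the self-adjoint operator \<open>M\<close>
  lies between \<open>0\<close> and \<open>(1 - s\<^sup>2) I\<close>. With \<open>\<beta> = (1 - s) / (1 + s)\<close> the errors obey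
  \<open>e\<^sub>k\<^sub>+\<^sub>2 = (1 + \<beta>) M e\<^sub>k\<^sub>+\<^sub>1 - \<beta> M e\<^sub>k\<close>.

  On an eigenvector of \<open>M\<close> with eigenvalue \<open>h\<close> this is a scalar recurrence whose
  characteristic polynomial \<open>r\<^sup>2 - (1 + \<beta>) h r + \<beta> h\<close> has no two distinct real roots for
  \<open>0 \<le> h \<le> 1 - s\<^sup>2\<close>, with a double root \<open>1 - s\<close> at the upper end: the momentum parameter is
  chosen for exactly this. Hence the errors decay like \<open>(1 - s)\<^sup>k\<close> up to a factor linear in \<open>k\<close>
  that the double root requires.

  The proof obtains this decay without diagonalizing \<open>M\<close>. For a scalar recurrence
  \<open>a\<^sub>k\<^sub>+\<^sub>2 = p a\<^sub>k\<^sub>+\<^sub>1 - q a\<^sub>k\<close> the form \<open>a\<^sub>k\<^sub>+\<^sub>1\<^sup>2 - p a\<^sub>k a\<^sub>k\<^sub>+\<^sub>1 + q a\<^sub>k\<^sup>2\<close> is multiplied by \<open>q\<close> in each step,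
  and it is positive semidefinite when the roots are not real and distinct. The operator
  version of this form, \<open>energy\<close>, contracts by \<open>(1 - s)\<^sup>2\<close> in each step (\<open>energy_step\<close>)
  and dominates \<open>\<parallel>e\<^sub>k\<^sub>+\<^sub>1 - M e\<^sub>k / (1 + s)\<parallel>\<^sup>2\<close> (\<open>norm_square_le_energy\<close>). As \<open>M / (1 + s)\<close> has norm at
  most \<open>1 - s\<close>, summing up gives \<open>\<parallel>e\<^sub>k\<parallel> \<le> (1 - s)\<^sup>k (1 + k / (1 + s)) \<parallel>e\<^sub>0\<parallel>\<close>
  (\<open>norm_recurrence_le\<close>).

  After \<open>k \<ge> 2 sqrt \<kappa> ln (2 / \<epsilon>)\<close> steps the exponential factor is at most \<open>(\<epsilon> / 2)\<^sup>2\<close>. One of the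
  two factors \<open>\<epsilon>\<close> pays for the linear factor, because \<open>\<epsilon> \<le> 1 / \<kappa>\<close> makes
  \<open>\<epsilon> sqrt \<kappa> ln (2 / \<epsilon>) \<le> sqrt \<epsilon> ln (2 / \<epsilon>)\<close> bounded
  (\<open>contraction_times_linear_le\<close>). So both \<open>x\<^sup>k\<^sup>-\<^sup>1\<close> and \<open>x\<^sup>k\<close> are within \<open>\<epsilon> \<parallel>x\<^sup>0 - x\<^sup>*\<parallel>\<close> of the
  minimizer, and then so is their midpoint.
\<close>

section \<open>Quadratic functions\<close>

lemma gradient_eqI:
  assumes "GDERIV f x :> g"
  shows "gradient f x = g"
  unfolding gradient_def
proof (rule the_equality)
  show "GDERIV f x :> g" by fact
next
  fix g' assume "GDERIV f x :> g'"
  then have "(\<lambda>h. h \<bullet> g') = (\<lambda>h. h \<bullet> g)"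
    using assms has_derivative_unique unfolding gderiv_def by blast
  then have "\<forall>h. h \<bullet> g' = h \<bullet> g" by metis
  then show "g' = g" by (simp only: vector_eq_ldot)
qed

lemma gderiv_quadratic:
  fixes A :: "real ^ 'n ^ 'n"
  shows "GDERIV (\<lambda>x. x \<bullet> (A *v x) + b \<bullet> x + c) x :> (A + transpose A) *v x + b"
proof -
  have "((\<lambda>x. x \<bullet> (A *v x) + b \<bullet> x + c) has_derivative
      (\<lambda>h. (x \<bullet> (A *v h) + h \<bullet> (A *v x)) + b \<bullet> h)) (at x)"
    by (auto intro!: derivative_eq_intros bounded_linear_imp_has_derivative)
  moreover have "x \<bullet> (A *v h) = h \<bullet> (transpose A *v x)" for h
    by (simp add: inner_commute flip: dot_lmul_matrix)
  ultimately show ?thesis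
    unfolding gderiv_def
    by (simp add: matrix_vector_mult_add_rdistrib inner_add_right inner_commute add_ac)
qed

lemma hessian_quadratic:
  fixes A :: "real ^ 'n ^ 'n"
  assumes "\<And>x. f x = x \<bullet> (A *v x) + b \<bullet> x + c"
  shows "hessian f x = A + transpose A"
proof -
  have f: "f = (\<lambda>x. x \<bullet> (A *v x) + b \<bullet> x + c)" using assms by auto
  have g: "gradient f = (\<lambda>x. (A + transpose A) *v x + b)"
    unfolding f by (rule ext, rule gradient_eqI, rule gderiv_quadratic)
  have "(gradient f has_derivative (\<lambda>h. (A + transpose A) *v h)) (at x)"
    unfolding g by (auto intro!: derivative_eq_intros bounded_linear_imp_has_derivative)
  then have "frechet_derivative (gradient f) (at x) = (\<lambda>h. (A + transpose A) *v h)"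
    by (metis frechet_derivative_at)
  then show ?thesis
    by (simp add: hessian_def jacobian_def)
qed

lemma gderiv_at_minimum:
  assumes "GDERIV f x :> g" and "\<And>y. f x \<le> f y"
  shows "g = 0"
proof -
  have "(\<lambda>h. h \<bullet> g) = (\<lambda>h. 0)"
    using has_derivative_local_min[of f "\<lambda>h. h \<bullet> g" x] assms
    unfolding gderiv_def by auto
  then show ?thesis
    by (metis inner_eq_zero_iff)
qed

lemma gradient_quadratic_minimizer:
  assumes "quadratic_function f" and "is_arg_min f (\<lambda>_. True) xmin"
  shows "gradient f x = hessian f xmin *v (x - xmin)"
    and "transpose (hessian f xmin) = hessian f xmin"
proof -
  obtain A b c where f: "\<And>x. f x = x \<bullet> (A *v x) + b \<bullet> x + c"
    using assms(1) unfolding quadratic_function_def by blast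
  have f': "f = (\<lambda>x. x \<bullet> (A *v x) + b \<bullet> x + c)" using f by auto
  have H: "hessian f xmin = A + transpose A" by (rule hessian_quadratic[OF f])
  have d: "GDERIV f x :> hessian f xmin *v x + b" for x
    unfolding H unfolding f' by (rule gderiv_quadratic)
  have "hessian f xmin *v xmin + b = 0"
    using assms(2) by (intro gderiv_at_minimum[OF d]) (auto simp: is_arg_min_linorder)
  then show "gradient f x = hessian f xmin *v (x - xmin)"
    using gradient_eqI[OF d, of x]
    by (simp add: matrix_vector_mult_diff_distrib eq_neg_iff_add_eq_0[symmetric])
  show "transpose (hessian f xmin) = hessian f xmin"
    unfolding H by (simp add: transpose_def vec_eq_iff)
qed

text \<open>The maximum \<open>l\<close> of the quadratic form on the unit sphere is an eigenvalue: the quadratic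
  function \<open>l * (x \<bullet> x) - x \<bullet> (A *v x)\<close> is nonnegative and vanishes at the maximizer \<open>v\<close>, so its
  gradient \<open>2 (l v - A v)\<close> at \<open>v\<close> is zero.\<close>

lemma symmetric_matrix_max_eigenvalue:
  fixes A :: "real ^ 'n ^ 'n"
  assumes "transpose A = A"
  obtains l where "eigenvalue A l" and "\<And>x. x \<bullet> (A *v x) \<le> l * (x \<bullet> x)"
proof -
  have "continuous_on (sphere (0 :: real ^ 'n) 1) (\<lambda>x. x \<bullet> (A *v x))"
    by (intro continuous_intros matrix_vector_mult_linear_continuous_on)
  moreover have "sphere (0 :: real ^ 'n) 1 \<noteq> {}"
    by (simp del: sphere_eq_empty add: sphere_eq_empty)
  ultimately obtain v :: "real ^ 'n" where v: "norm v = 1"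
    and max: "\<And>y. norm y = 1 \<Longrightarrow> y \<bullet> (A *v y) \<le> v \<bullet> (A *v v)"
    using continuous_attains_sup[of "sphere 0 1" "\<lambda>x :: real ^ 'n. x \<bullet> (A *v x)"] by auto
  define l where "l = v \<bullet> (A *v v)"
  have le: "x \<bullet> (A *v x) \<le> l * (x \<bullet> x)" for x
  proof (cases "x = 0")
    case False
    have "(x /\<^sub>R norm x) \<bullet> (A *v (x /\<^sub>R norm x)) \<le> l"
      unfolding l_def by (rule max) (use False in simp)
    moreover have "(x /\<^sub>R norm x) \<bullet> (A *v (x /\<^sub>R norm x)) = x \<bullet> (A *v x) / (x \<bullet> x)"
      by (simp add: matrix_vector_mult_scaleR dot_square_norm power2_eq_square field_simps)
    ultimately show ?thesis
      using False by (simp add: divide_le_eq)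
  qed simp
  define B where "B = l *\<^sub>R mat 1 - A"
  have B: "B *v x = l *\<^sub>R x - A *v x" for x
    unfolding B_def
    by (simp add: matrix_vector_mult_diff_rdistrib scaleR_matrix_vector_assoc[symmetric])
  have "transpose B = B"
    using assms unfolding B_def
    by (simp add: transpose_def vec_eq_iff mat_def)
  then have "(B + transpose B) *v v + 0 = 0"
    using le v
    by (intro gderiv_at_minimum[OF gderiv_quadratic[of B 0 0]])
      (auto simp: B inner_diff_right l_def dot_square_norm)
  then have "B *v v + B *v v = 0"
    by (simp only: \<open>transpose B = B\<close> matrix_vector_mult_add_rdistrib add_0_right)
  then have "B *v v = 0"
    by (simp flip: scaleR_2)
  then have "eigenvalue A l"
    using v unfolding eigenvalue_def B by (intro exI[of _ v]) auto
  then show ?thesis using le that by blast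
qed

lemma eigenvalue_bounds_quadratic_form:
  fixes A :: "real ^ 'n ^ 'n"
  assumes "transpose A = A"
  shows "(\<And>l. eigenvalue A l \<Longrightarrow> l \<le> M) \<Longrightarrow> x \<bullet> (A *v x) \<le> M * (x \<bullet> x)"
    and "(\<And>l. eigenvalue A l \<Longrightarrow> m \<le> l) \<Longrightarrow> m * (x \<bullet> x) \<le> x \<bullet> (A *v x)"
proof -
  assume M: "\<And>l. eigenvalue A l \<Longrightarrow> l \<le> M"
  obtain l where "eigenvalue A l" "x \<bullet> (A *v x) \<le> l * (x \<bullet> x)"
    using symmetric_matrix_max_eigenvalue[OF assms] by metis
  with M show "x \<bullet> (A *v x) \<le> M * (x \<bullet> x)"
    by (meson inner_ge_zero mult_right_mono order_trans)
next
  assume m: "\<And>l. eigenvalue A l \<Longrightarrow> m \<le> l"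
  have neg: "(- A) *v y = - (A *v y)" for y
    by (simp add: matrix_vector_mult_def vec_eq_iff sum_negf)
  have "transpose (- A) = - A"
    using assms by (simp add: transpose_def vec_eq_iff)
  then obtain l where l: "eigenvalue (- A) l" "x \<bullet> ((- A) *v x) \<le> l * (x \<bullet> x)"
    using symmetric_matrix_max_eigenvalue by metis
  have "eigenvalue A (- l)"
    using l(1) unfolding eigenvalue_def neg by (metis minus_equation_iff scaleR_minus_left)
  then have "m * (x \<bullet> x) \<le> (- l) * (x \<bullet> x)"
    by (intro mult_right_mono m) auto
  with l(2) show "m * (x \<bullet> x) \<le> x \<bullet> (A *v x)"
    by (simp add: neg)
qed

section \<open>An energy for the momentum recurrence\<close>

text \<open>In the application \<open>M\<close> is the gradient step \<open>I - \<alpha> H\<close> and \<open>s\<^sup>2\<close> is the reciprocal of the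
  condition number bound.\<close>

locale bounded_selfadjoint =
  fixes M :: "'a::real_inner \<Rightarrow> 'a" and s :: real
  assumes linear: "linear M"
    and selfadjoint: "M x \<bullet> y = x \<bullet> M y"
    and nonneg: "0 \<le> x \<bullet> M x"
    and bounded: "x \<bullet> M x \<le> (1 - s\<^sup>2) * (x \<bullet> x)"
    and s: "0 < s" "s < 1"
begin

text \<open>With momentum \<open>\<beta> = (1 - s) / (1 + s)\<close>, so that \<open>1 + \<beta> = 2 / (1 + s)\<close>, this is the form
  \<open>u\<^sup>2 - p w u + q w\<^sup>2\<close> belonging to the recurrence with coefficients \<open>p = (1 + \<beta>) M\<close> and
  \<open>q = \<beta> M\<close>. The arguments are two consecutive iterates, the older one first.\<close>

definition energy :: "'a \<Rightarrow> 'a \<Rightarrow> real" where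
  "energy w u = u \<bullet> u - 2 / (1 + s) * (u \<bullet> M w) + (1 - s) / (1 + s) * (w \<bullet> M w)"

lemmas M_simps = linear_add[OF linear] linear_diff[OF linear] linear_cmul[OF linear]

lemma gap_pos: "0 < 1 - s\<^sup>2"
  using s by (simp add: power_less_one_iff)

text \<open>This is \<open>M (g - M) \<ge> 0\<close> for \<open>g = 1 - s\<^sup>2\<close>. Both factors are nonnegative and commute, and
  \<open>g M (g - M) = (g - M) M (g - M) + M (g - M) M\<close> writes the product as a sum of
  congruences of nonnegative operators.\<close>

lemma M_square_le: "M x \<bullet> M x \<le> (1 - s\<^sup>2) * (x \<bullet> M x)"
proof -
  define g where "g = 1 - s\<^sup>2"
  have "0 \<le> (g *\<^sub>R x - M x) \<bullet> M (g *\<^sub>R x - M x) + (g * (M x \<bullet> M x) - M x \<bullet> M (M x))"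
    using nonneg bounded[of "M x"] unfolding g_def by simp
  also have "\<dots> = g * (g * (x \<bullet> M x) - M x \<bullet> M x)"
    by (simp add: M_simps inner_diff_left inner_diff_right selfadjoint algebra_simps)
  finally show ?thesis
    using gap_pos unfolding g_def by (simp add: zero_le_mult_iff)
qed

lemma norm_M_le: "norm (M x) \<le> (1 - s\<^sup>2) * norm x"
proof -
  have "M x \<bullet> M x \<le> (1 - s\<^sup>2) * ((1 - s\<^sup>2) * (x \<bullet> x))"
    by (meson M_square_le bounded gap_pos less_imp_le mult_left_mono order_trans)
  also have "\<dots> = ((1 - s\<^sup>2) * norm x)\<^sup>2"
    by (simp only: power_mult_distrib power2_norm_eq_inner power2_eq_square[of "1 - s\<^sup>2"] mult.assoc)
  finally have "(norm (M x))\<^sup>2 \<le> ((1 - s\<^sup>2) * norm x)\<^sup>2"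
    by (simp only: power2_norm_eq_inner)
  then show ?thesis
    by (rule power2_le_imp_le) (use gap_pos in simp)
qed

text \<open>Completing the square in \<open>u\<close> leaves the remainder \<open>w \<bullet> M (1 - s\<^sup>2 - M) w / (1 + s)\<^sup>2\<close>. It is here
  that the choice of \<open>\<beta>\<close> matters: it makes the discriminant vanish at the upper
  bound \<open>1 - s\<^sup>2\<close> of \<open>M\<close>, so the remainder is nonnegative.\<close>

lemma norm_square_le_energy:
  "(norm (u - (1 / (1 + s)) *\<^sub>R M w))\<^sup>2 \<le> energy w u"
proof -
  define c where "c = 1 / (1 + s)"
  have c: "2 / (1 + s) = 2 * c" "(1 - s) / (1 + s) = (1 - s\<^sup>2) * c\<^sup>2"
    unfolding c_def using s
    by (simp_all add: divide_simps) (simp add: power2_eq_square algebra_simps)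
  have "energy w u - (norm (u - c *\<^sub>R M w))\<^sup>2
      = c\<^sup>2 * ((1 - s\<^sup>2) * (w \<bullet> M w) - M w \<bullet> M w)"
    unfolding energy_def c power2_norm_eq_inner
    by (simp add: inner_diff_left inner_diff_right inner_commute algebra_simps power2_eq_square)
  moreover have "0 \<le> c\<^sup>2 * ((1 - s\<^sup>2) * (w \<bullet> M w) - M w \<bullet> M w)"
    using M_square_le[of w] by simp
  ultimately show ?thesis unfolding c_def by linarith
qed

text \<open>A step multiplies the form by \<open>\<beta> M\<close>, and \<open>\<beta> M \<le> \<beta> (1 - s\<^sup>2) = (1 - s)\<^sup>2\<close>. Since the
  form is operator valued, the comparison needs an argument: weighting the form with
  \<open>N = 1 - s\<^sup>2 - M\<close> and completing the square as before gives
  \<open>z \<bullet> N z + N w \<bullet> M (N w) / (1 + s)\<^sup>2\<close> for \<open>z = u - M w / (1 + s)\<close>, and both terms are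
  nonnegative.\<close>

lemma energy_step:
  "energy u ((2 / (1 + s)) *\<^sub>R M u - ((1 - s) / (1 + s)) *\<^sub>R M w) \<le> (1 - s)\<^sup>2 * energy w u"
proof -
  define c where "c = 1 / (1 + s)"
  define b where "b = (1 - s) / (1 + s)"
  define g where "g = 1 - s\<^sup>2"
  have b: "b = g * c\<^sup>2" and bg: "b * g = (1 - s)\<^sup>2" and c: "2 / (1 + s) = 2 * c"
    unfolding b_def g_def c_def using s
    by (simp_all add: divide_simps) (simp_all add: power2_eq_square algebra_simps)
  have b0: "0 \<le> b" unfolding b_def using s by simp
  define z where "z = u - c *\<^sub>R M w"
  \<comment> \<open>\<open>w'\<close> is \<open>N w\<close>.\<close>
  define w' where "w' = g *\<^sub>R w - M w"
  have "energy u ((2 * c) *\<^sub>R M u - b *\<^sub>R M w)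
      = b * (u \<bullet> M u - 2 * c * (M u \<bullet> M w) + b * (M w \<bullet> M w))"
    unfolding energy_def c b_def[symmetric]
    by (simp add: inner_diff_left inner_diff_right inner_commute algebra_simps)
  moreover have "w \<bullet> M u = u \<bullet> M w" "w \<bullet> M (M u) = u \<bullet> M (M w)"
    using selfadjoint inner_commute by metis+
  then have "g * energy w u - (u \<bullet> M u - 2 * c * (M u \<bullet> M w) + b * (M w \<bullet> M w))
      = (g * (z \<bullet> z) - z \<bullet> M z) + c\<^sup>2 * (w' \<bullet> M w')"
    unfolding energy_def c b_def[symmetric] b z_def w'_def
    by (simp add: M_simps inner_diff_left inner_diff_right selfadjoint
        algebra_simps power2_eq_square)
  moreover have "0 \<le> (g * (z \<bullet> z) - z \<bullet> M z) + c\<^sup>2 * (w' \<bullet> M w')"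
    using bounded[of z] nonneg[of w'] unfolding g_def by simp
  ultimately have "energy u ((2 * c) *\<^sub>R M u - b *\<^sub>R M w) \<le> b * (g * energy w u)"
    using b0 by (simp add: mult_left_mono)
  then show ?thesis
    unfolding c b_def[symmetric] bg[symmetric] by (simp add: mult.assoc)
qed

text \<open>The method starts with \<open>y\<^sup>0 = x\<^sup>0\<close> instead of a gradient step, so the first step
  subtracts \<open>\<beta> x\<close> and not \<open>\<beta> M w\<close> for an earlier \<open>w\<close>. The energy of the first pair is
  exactly \<open>\<beta>\<^sup>2 x \<bullet> (I - M) x\<close>.\<close>

lemma energy_initial:
  "energy x ((2 / (1 + s)) *\<^sub>R M x - ((1 - s) / (1 + s)) *\<^sub>R x)
     \<le> ((1 - s) / (1 + s) * norm x)\<^sup>2"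
proof -
  define b where "b = (1 - s) / (1 + s)"
  have c: "2 / (1 + s) = 1 + b" unfolding b_def using s by (simp add: field_simps)
  have "energy x ((1 + b) *\<^sub>R M x - b *\<^sub>R x) = b\<^sup>2 * (x \<bullet> x) - b\<^sup>2 * (x \<bullet> M x)"
    unfolding energy_def c b_def[symmetric]
    by (simp add: inner_diff_left inner_diff_right inner_commute algebra_simps power2_eq_square)
  also have "\<dots> \<le> (b * norm x)\<^sup>2"
    using nonneg[of x] by (simp add: power_mult_distrib power2_norm_eq_inner)
  finally show ?thesis unfolding c b_def[symmetric] .
qed

text \<open>Each \<open>e\<^sub>k\<^sub>+\<^sub>1\<close> differs from \<open>M e\<^sub>k / (1 + s)\<close>, whose norm is at most \<open>(1 - s) \<parallel>e\<^sub>k\<parallel>\<close>, by at most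
  the square root of the energy, which itself has order \<open>(1 - s)\<^sup>k\<^sup>+\<^sup>1\<close>. This resonance
  produces the linear factor.\<close>

lemma norm_recurrence_le:
  fixes e :: "nat \<Rightarrow> 'a"
  assumes e1: "e 1 = (2 / (1 + s)) *\<^sub>R M (e 0) - ((1 - s) / (1 + s)) *\<^sub>R e 0"
    and step: "\<And>k. e (Suc (Suc k))
      = (2 / (1 + s)) *\<^sub>R M (e (Suc k)) - ((1 - s) / (1 + s)) *\<^sub>R M (e k)"
  shows "norm (e k) \<le> (1 - s) ^ k * (1 + k / (1 + s)) * norm (e 0)"
proof -
  have E: "energy (e k) (e (Suc k)) \<le> ((1 - s) ^ Suc k / (1 + s) * norm (e 0))\<^sup>2" for k
  proof (induction k)
    case 0
    show ?case using energy_initial[of "e 0"] e1 by simp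
  next
    case (Suc k)
    have "energy (e (Suc k)) (e (Suc (Suc k))) \<le> (1 - s)\<^sup>2 * energy (e k) (e (Suc k))"
      unfolding step by (rule energy_step)
    also have "\<dots> \<le> (1 - s)\<^sup>2 * ((1 - s) ^ Suc k / (1 + s) * norm (e 0))\<^sup>2"
      by (rule mult_left_mono[OF Suc.IH]) simp
    finally show ?case
      by (simp add: power_mult_distrib[symmetric] mult.assoc[symmetric])
  qed
  show ?thesis
  proof (induction k)
    case 0
    show ?case by simp
  next
    case (Suc k)
    have "(norm (e (Suc k) - (1 / (1 + s)) *\<^sub>R M (e k)))\<^sup>2
        \<le> ((1 - s) ^ Suc k / (1 + s) * norm (e 0))\<^sup>2"
      using norm_square_le_energy E order_trans by blast
    then have d: "norm (e (Suc k) - (1 / (1 + s)) *\<^sub>R M (e k))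
        \<le> (1 - s) ^ Suc k / (1 + s) * norm (e 0)"
      by (rule power2_le_imp_le) (use s in simp)
    have "norm ((1 / (1 + s)) *\<^sub>R M (e k)) \<le> (1 / (1 + s)) * ((1 - s\<^sup>2) * norm (e k))"
      using norm_M_le[of "e k"] s by (simp add: divide_right_mono)
    also have "\<dots> = (1 - s) * norm (e k)"
      using s by (simp add: field_simps power2_eq_square)
    also have "\<dots> \<le> (1 - s) * ((1 - s) ^ k * (1 + k / (1 + s)) * norm (e 0))"
      using Suc.IH s by (intro mult_left_mono) auto
    finally have "norm (e (Suc k)) \<le> (1 - s) ^ Suc k / (1 + s) * norm (e 0)
        + (1 - s) * ((1 - s) ^ k * (1 + k / (1 + s)) * norm (e 0))"
      using d norm_triangle_sub[of "e (Suc k)" "(1 / (1 + s)) *\<^sub>R M (e k)"] by linarith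
    also have "\<dots> = (1 - s) ^ Suc k * (1 + Suc k / (1 + s)) * norm (e 0)"
      by (simp add: add_divide_distrib distrib_left distrib_right mult_ac)
    finally show ?case .
  qed
qed

end

section \<open>The number of steps\<close>

text \<open>At \<open>T = 2 / s * ln (2 / \<epsilon>)\<close> the decay \<open>exp (- s * T)\<close> equals \<open>(\<epsilon> / 2)\<^sup>2\<close>, and beyond \<open>T \<ge> 1 / s\<close>
  the linear factor grows at most by the factor \<open>exp (s * (k - T))\<close>. So only \<open>\<epsilon> * (1 + T) \<le> 4\<close> remains;
  it holds because \<open>\<epsilon> \<le> s\<^sup>2\<close> gives \<open>\<epsilon> * T \<le> 2 * sqrt \<epsilon> * ln (2 / \<epsilon>)\<close> and the logarithm is at most
  \<open>sqrt (2 / \<epsilon>)\<close>.\<close>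

lemma contraction_times_linear_le:
  fixes s \<epsilon> :: real
  assumes s: "0 < s" "s < 1" and \<epsilon>: "0 < \<epsilon>" "\<epsilon> \<le> s\<^sup>2"
    and k: "2 / s * ln (2 / \<epsilon>) \<le> real k"
  shows "(1 - s) ^ k * (1 + k / (1 + s)) \<le> \<epsilon>"
proof -
  define L where "L = ln (2 / \<epsilon>)"
  define T where "T = 2 / s * L"
  have "\<epsilon> < 1" using \<epsilon> s by (smt (verit) power_less_one_iff zero_less_numeral)
  have "1 - 1 / (2 / \<epsilon>) \<le> L"
    unfolding L_def using \<epsilon> ln_le_minus_one[of "\<epsilon> / 2"] by (simp add: ln_div)
  then have L: "1 / 2 \<le> L" using \<open>\<epsilon> < 1\<close> by simp
  then have T: "1 / s \<le> T" "0 \<le> T"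
    unfolding T_def using s by (simp_all add: field_simps)
  have "(1 - s) ^ k \<le> exp (- s) ^ k"
    using s exp_ge_add_one_self[of "- s"] by (intro power_mono) auto
  also have "\<dots> = exp (- s * T) * exp (- s * (k - T))"
    by (simp add: exp_of_nat_mult[symmetric] exp_add[symmetric] algebra_simps)
  also have "exp (- s * T) = (\<epsilon> / 2)\<^sup>2"
  proof -
    have "- s * T = L * (- 2)" unfolding T_def using s by simp
    also have "exp \<dots> = (\<epsilon> / 2)\<^sup>2"
      unfolding L_def using \<epsilon> by (simp add: exp_minus exp_double mult.commute power_divide divide_simps)
    finally show ?thesis .
  qed
  finally have decay: "(1 - s) ^ k \<le> (\<epsilon> / 2)\<^sup>2 * exp (- s * (k - T))" .
  have growth: "1 + k \<le> (1 + T) * exp (s * (k - T))"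
  proof -
    have "1 + k = (1 + T) * (1 + (k - T) / (1 + T))" using T by (simp add: field_simps)
    also have "\<dots> \<le> (1 + T) * exp ((k - T) / (1 + T))"
      using T by (intro mult_left_mono exp_ge_add_one_self) auto
    also have "\<dots> \<le> (1 + T) * exp (s * (k - T))"
    proof -
      have "1 / (1 + T) \<le> s" using T s by (simp add: field_simps)
      then have "(k - T) * (1 / (1 + T)) \<le> (k - T) * s"
        using k unfolding T_def L_def by (intro mult_left_mono) auto
      then show ?thesis using T by (intro mult_left_mono) (auto simp: mult.commute)
    qed
    finally show ?thesis by simp
  qed
  have "(1 - s) ^ k * (1 + k / (1 + s)) \<le> (1 - s) ^ k * (1 + k)"
    using s by (intro mult_left_mono) (auto simp: field_simps)
  also have "\<dots> \<le> ((\<epsilon> / 2)\<^sup>2 * exp (- s * (k - T))) * ((1 + T) * exp (s * (k - T)))"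
    using decay growth by (intro mult_mono) auto
  also have "\<dots> = (\<epsilon> / 2)\<^sup>2 * (1 + T)"
    by (simp add: exp_minus)
  also have "\<dots> \<le> \<epsilon>"
  proof -
    define w where "w = sqrt (2 / \<epsilon>)"
    have w: "0 < w" "w\<^sup>2 = 2 / \<epsilon>" unfolding w_def using \<epsilon> by auto
    have "ln (w / 2) \<le> w / 2 - 1" using w by (intro ln_le_minus_one) simp
    then have "ln w \<le> w / 2" using w ln_2_less_1 by (simp add: ln_div)
    moreover have "L = 2 * ln w"
      unfolding L_def w(2)[symmetric] using w(1) by (simp add: ln_realpow)
    ultimately have "L \<le> w" by simp
    have "sqrt \<epsilon> \<le> s" using \<epsilon> s by (simp add: real_le_lsqrt)
    have "\<epsilon> * T \<le> 2 * sqrt \<epsilon> * L"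
    proof -
      have "\<epsilon> / s \<le> sqrt \<epsilon>"
        using \<open>sqrt \<epsilon> \<le> s\<close> s \<epsilon> mult_left_mono[of "sqrt \<epsilon>" s "sqrt \<epsilon>"]
        by (simp add: divide_le_eq)
      then have "2 * L * (\<epsilon> / s) \<le> 2 * L * sqrt \<epsilon>" using L by (intro mult_left_mono) auto
      then show ?thesis unfolding T_def by (simp add: mult_ac)
    qed
    also have "\<dots> \<le> 2 * sqrt \<epsilon> * w"
      using \<open>L \<le> w\<close> \<epsilon> by (intro mult_left_mono) auto
    also have "\<dots> = 2 * sqrt 2"
      unfolding w_def using \<epsilon> by (simp add: real_sqrt_divide)
    also have "\<dots> \<le> 3"
    proof -
      have "sqrt 2 \<le> 3 / 2" by (rule real_le_lsqrt) (simp_all add: power2_eq_square)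
      then show ?thesis by simp
    qed
    finally have "\<epsilon> * (1 + T) \<le> 4" using \<open>\<epsilon> < 1\<close> by (simp add: algebra_simps)
    then have "\<epsilon> / 4 * (\<epsilon> * (1 + T)) \<le> \<epsilon> / 4 * 4" using \<epsilon> by (intro mult_left_mono) auto
    then show ?thesis by (simp add: power2_eq_square mult_ac)
  qed
  finally show ?thesis .
qed

section \<open>The convergence rate\<close>

theorem theorem2:
  fixes f :: "real ^ 'n \<Rightarrow> real"
    and xmin x0 :: "real ^ 'n"
    and H :: "real ^ 'n ^ 'n"
    and m_up m_low \<kappa> \<alpha> \<alpha>_low \<beta> \<epsilon> :: real
    and k :: nat
  assumes "quadratic_function f"
    and "strictly_convex_on UNIV f"
    and "is_arg_min f (\<lambda>_. True) xmin"
    and "H = hessian f xmin"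
    and "\<And>l. eigenvalue H l \<Longrightarrow> l \<le> m_up"
    and "m_low > 0"
    and "\<And>l. eigenvalue H l \<Longrightarrow> m_low \<le> l"
    and "\<kappa> = m_up / m_low"
    and "\<kappa> \<ge> 28"
    and "\<alpha> = 1 / m_up"
    and "\<alpha>_low = 1 / \<kappa>"
    and "\<beta> = (1 - sqrt \<alpha>_low)\<^sup>2 / (1 - \<alpha>_low)"
    and "0 < \<epsilon>"
    and "\<epsilon> \<le> 1 / \<kappa>"
    and "int k = 1 + \<lceil>2 * sqrt \<kappa> * ln (2 / \<epsilon>)\<rceil>"
  shows "norm ((1 / 2) *\<^sub>R (nag_x \<alpha> \<beta> f x0 (k - 1) + nag_x \<alpha> \<beta> f x0 k) - xmin)
           \<le> \<epsilon> * norm (x0 - xmin)"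
proof -
  define s where "s = 1 / sqrt \<kappa>"
  have s2: "s\<^sup>2 = 1 / \<kappa>" and s: "0 < s" "s < 1"
    unfolding s_def using \<open>\<kappa> \<ge> 28\<close> by (auto simp: power_divide)
  have "0 < m_up"
    using \<open>\<kappa> = m_up / m_low\<close> \<open>\<kappa> \<ge> 28\<close> \<open>m_low > 0\<close> by (smt (verit) divide_nonpos_pos)
  have \<alpha>: "\<alpha> * m_low = s\<^sup>2" "\<alpha> * m_up = 1" "0 < \<alpha>"
    using \<open>\<alpha> = 1 / m_up\<close> \<open>\<kappa> = m_up / m_low\<close> \<open>m_low > 0\<close> \<open>0 < m_up\<close> s2 by auto
  have "sqrt \<alpha>_low = s"
    unfolding \<open>\<alpha>_low = 1 / \<kappa>\<close> s_def by (simp add: real_sqrt_divide)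
  then have "\<beta> = (1 - s)\<^sup>2 / (1 - s\<^sup>2)"
    using \<open>\<beta> = _\<close> \<open>\<alpha>_low = 1 / \<kappa>\<close> s2 by simp
  also have "1 - s\<^sup>2 = (1 - s) * (1 + s)" by (simp add: power2_eq_square algebra_simps)
  finally have \<beta>: "\<beta> = (1 - s) / (1 + s)" using s by (simp add: power2_eq_square)
  have \<beta>1: "2 / (1 + s) = 1 + \<beta>" unfolding \<beta> using s by (simp add: field_simps)

  note grad = gradient_quadratic_minimizer(1)[OF \<open>quadratic_function f\<close>
      \<open>is_arg_min f (\<lambda>_. True) xmin\<close>, folded \<open>H = hessian f xmin\<close>]
  note sym = gradient_quadratic_minimizer(2)[OF \<open>quadratic_function f\<close>
      \<open>is_arg_min f (\<lambda>_. True) xmin\<close>, folded \<open>H = hessian f xmin\<close>]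
  have upper: "x \<bullet> (H *v x) \<le> m_up * (x \<bullet> x)" for x
    using assms(5) by (rule eigenvalue_bounds_quadratic_form(1)[OF sym])
  have lower: "m_low * (x \<bullet> x) \<le> x \<bullet> (H *v x)" for x
    using assms(7) by (rule eigenvalue_bounds_quadratic_form(2)[OF sym])

  define M where "M x = x - \<alpha> *\<^sub>R (H *v x)" for x
  interpret bounded_selfadjoint M s
  proof (rule bounded_selfadjoint.intro)
    show "linear M"
      unfolding M_def
      by (intro linear_compose_sub linear_ident linear_compose_scale_right) simp
    show "M x \<bullet> y = x \<bullet> M y" for x y
      unfolding M_def
      by (simp add: inner_diff_left inner_diff_right) (metis dot_lmul_matrix sym vector_transpose_matrix)
    show "0 \<le> x \<bullet> M x" for x
      using mult_left_mono[OF upper[of x], of \<alpha>] \<alpha>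
      by (simp add: M_def inner_diff_right mult.assoc[symmetric])
    show "x \<bullet> M x \<le> (1 - s\<^sup>2) * (x \<bullet> x)" for x
      using mult_left_mono[OF lower[of x], of \<alpha>] \<alpha>
      by (simp add: M_def inner_diff_right mult.assoc[symmetric] algebra_simps)
  qed (use s in auto)

  define e where "e j = nag_x \<alpha> \<beta> f x0 j - xmin" for j
  \<comment> \<open>For \<open>j = 0\<close> the subtracted error is \<open>nag_y 0 - xmin = e 0\<close>; later it is \<open>M\<close> of the previous
    error. Hence the two different shapes of the recurrence.\<close>
  have y: "nag_y \<alpha> \<beta> f x0 (Suc j) - xmin = M (e j)" for j
    by (simp add: M_def e_def grad)
  have x: "e (Suc j) = (1 + \<beta>) *\<^sub>R M (e j) - \<beta> *\<^sub>R (nag_y \<alpha> \<beta> f x0 j - xmin)" for j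
    unfolding y[symmetric] unfolding e_def by (simp add: algebra_simps del: nag_y.simps)
  have rate: "norm (e j) \<le> (1 - s) ^ j * (1 + j / (1 + s)) * norm (e 0)" for j
  proof (rule norm_recurrence_le[of e])
    show "e 1 = (2 / (1 + s)) *\<^sub>R M (e 0) - ((1 - s) / (1 + s)) *\<^sub>R e 0"
      using x[of 0] unfolding \<beta>1 \<beta>[symmetric] by (simp add: e_def)
    show "e (Suc (Suc i)) = (2 / (1 + s)) *\<^sub>R M (e (Suc i)) - ((1 - s) / (1 + s)) *\<^sub>R M (e i)" for i
      using x[of "Suc i"] unfolding \<beta>1 \<beta>[symmetric] y .
  qed
  have small: "norm (e j) \<le> \<epsilon> * norm (x0 - xmin)" if "2 * sqrt \<kappa> * ln (2 / \<epsilon>) \<le> real j" for j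
  proof -
    have "(1 - s) ^ j * (1 + j / (1 + s)) \<le> \<epsilon>"
      using that s \<open>0 < \<epsilon>\<close> \<open>\<epsilon> \<le> 1 / \<kappa>\<close> s2
      by (intro contraction_times_linear_le) (auto simp: s_def)
    then have "(1 - s) ^ j * (1 + j / (1 + s)) * norm (e 0) \<le> \<epsilon> * norm (e 0)"
      by (rule mult_right_mono) simp
    with rate[of j] show ?thesis by (simp add: e_def)
  qed
  have "0 \<le> ln (2 / \<epsilon>)"
    using \<open>0 < \<epsilon>\<close> \<open>\<epsilon> \<le> 1 / \<kappa>\<close> s s2 by (smt (verit) le_divide_eq_1_pos ln_ge_zero power_le_one)
  then have "0 \<le> 2 * sqrt \<kappa> * ln (2 / \<epsilon>)" using \<open>\<kappa> \<ge> 28\<close> by simp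
  then have k: "2 * sqrt \<kappa> * ln (2 / \<epsilon>) \<le> real (k - 1)"
    using \<open>int k = _\<close> by linarith
  have "(1 / 2) *\<^sub>R (nag_x \<alpha> \<beta> f x0 (k - 1) + nag_x \<alpha> \<beta> f x0 k) - xmin
      = (1 / 2) *\<^sub>R (e (k - 1) + e k)"
    by (simp add: e_def algebra_simps flip: scaleR_2)
  also have "norm \<dots> \<le> (norm (e (k - 1)) + norm (e k)) / 2"
    using norm_triangle_ineq[of "e (k - 1)" "e k"] by simp
  also have "\<dots> \<le> \<epsilon> * norm (x0 - xmin)"
  proof -
    have "real (k - 1) \<le> real k" by simp
    with k have "norm (e (k - 1)) \<le> \<epsilon> * norm (x0 - xmin)" "norm (e k) \<le> \<epsilon> * norm (x0 - xmin)"
      by (auto intro!: small)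
    then have "norm (e (k - 1)) + norm (e k) \<le> \<epsilon> * norm (x0 - xmin) + \<epsilon> * norm (x0 - xmin)"
      by (rule add_mono)
    then show ?thesis by simp
  qed
  finally show ?thesis .
qed

end
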